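(* Let $k$ be a field, $n\ge2$, $\rho\colon F_n\rtimes B_n\to\mathrm{GL}(V)$ a representation on a finite-dimensional $k$-vector space, and $\lambda\in k^\times\setminus\{1\}$. Let $a,b\in k^\times$, put $\mu:=-b/a$, $X_i:=a^{-1}\rho^{\mathrm{LM}}_\lambda(\sigma_i)$ and $T_i:=a^{-1}\rho^{\mathrm{KLM}}_\lambda(\sigma_i)$ for $1\le i\le n-1$, and suppose that $$(X_i-1)(X_i+\mu)\,V^{\oplus n}\subseteq K+L\qquad(1\le i\le n-1),$$ so that the $T_i$ satisfy the Hecke relation $(T_i-1)(T_i+\mu)=0$. Then the $T_i$ satisfy $$(1-T_i)^2=(1+\mu)(1-T_i),\qquad(1-T_i)(1-T_{i\pm1})(1-T_i)=\mu(1-T_i)$$ (for all indices for which the terms are defined) if and only if, in addition, $$\Bigl[(1-X_i)(1-X_{i+1})(1-X_i)-\mu(1-X_i)\Bigr]V^{\oplus n}\subseteq K+L\qquad(1\le i\le n-2),$$ together with the mirror containment with $i$ and $i+1$ interchanged, $$\Bigl[(1-X_{i+1})(1-X_{i})(1-X_{i+1})-\mu(1-X_{i+1})\Bigr]V^{\oplus n}\subseteq K+L\qquad(1\le i\le n-2).$$ Moreover, the far commutation $(1-T_i)(1-T_j)=(1-T_j)(1-T_i)$ for $|i-j|\ge2$ is automatic.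
   Context: $B_n$ is the Artin braid group with standard generators $\sigma_1,\dots,\sigma_{n-1}$; $F_n$ is the free group on $x_1,\dots,x_n$. The Artin action $\theta\colon B_n\to\mathrm{Aut}(F_n)$ is $\theta_{\sigma_i}(x_i)=x_{i+1}$, $\theta_{\sigma_i}(x_{i+1})=x_{i+1}^{-1}x_ix_{i+1}$, $\theta_{\sigma_i}(x_j)=x_j$ for $j\ne i,i+1$. $F_n\rtimes B_n$ is the corresponding semidirect product, in which $\sigma x\sigma^{-1}=\theta_\sigma(x)$. Write $N=\dim V$, $g_i:=\rho(x_i)$, $s_i:=\rho(\sigma_i)$. Twisted Long--Moody construction: for $\lambda\in k^\times$, $\rho^{\mathrm{LM}}_\lambda\colon F_n\rtimes B_n\to\mathrm{GL}(V^{\oplus n})$ is the representation given on generators as follows, in $n\times n$ block form with $N\times N$ blocks. $\rho^{\mathrm{LM}}_\lambda(x_i)$ is the identity matrix except in the $i$-th block row, which equals $(\lambda(g_1-1),\dots,\lambda(g_{i-1}-1),\lambda g_i,g_{i+1}-1,\dots,g_n-1)$. $\rho^{\mathrm{LM}}_\lambda(\sigma_i)=s_i^{\oplus n}\cdot\mathrm{diag}(I_{N(i-1)},R_i,I_{N(n-i-1)})$ with $R_i=\begin{pmatrix}O&g_i\\ I_N&I_N-g_{i+1}\end{pmatrix}$ in block rows and columns $i,i+1$. Katz--Long--Moody (KLM) construction: let $K=\{(w_1,\dots,w_n)^T: w_j\in\mathrm{Ker}(g_j-1)\}$ and $L=\bigcap_{j=1}^n\mathrm{Ker}(\rho^{\mathrm{LM}}_\lambda(x_j)-I)$.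 The subspace $K+L$ is $\rho^{\mathrm{LM}}_\lambda$-invariant, and $\rho^{\mathrm{KLM}}_\lambda$ is the induced representation of $F_n\rtimes B_n$ on $V^{\oplus n}/(K+L)$. *)

theory Defs
  imports Complex_Main "HOL-Algebra.Bij" "HOL-Library.Set_Algebras" "HOL-Library.Function_Algebras"
begin

section \<open>Presented groups\<close>

text \<open>A letter \<open>(x, True)\<close> stands for the generator \<open>x\<close>, and \<open>(x, False)\<close> for its inverse.\<close>

type_synonym 'g word = "('g \<times> bool) list"

definition words :: "'g set \<Rightarrow> 'g word set" where
  "words X = lists (X \<times> UNIV)"

inductive_set pres_rel :: "'g set \<Rightarrow> ('g word \<times> 'g word) set \<Rightarrow> ('g word \<times> 'g word) set"
  for X R where
  refl: "w \<in> words X \<Longrightarrow> (w, w) \<in> pres_rel X R"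
| sym: "(v, w) \<in> pres_rel X R \<Longrightarrow> (w, v) \<in> pres_rel X R"
| trans: "(u, v) \<in> pres_rel X R \<Longrightarrow> (v, w) \<in> pres_rel X R \<Longrightarrow> (u, w) \<in> pres_rel X R"
| cancel: "u \<in> words X \<Longrightarrow> v \<in> words X \<Longrightarrow> x \<in> X \<Longrightarrow>
    (u @ [(x, e), (x, \<not> e)] @ v, u @ v) \<in> pres_rel X R"
| relator: "u \<in> words X \<Longrightarrow> v \<in> words X \<Longrightarrow> l \<in> words X \<Longrightarrow> r \<in> words X \<Longrightarrow> (l, r) \<in> R \<Longrightarrow>
    (u @ l @ v, u @ r @ v) \<in> pres_rel X R"

definition presented_group :: "'g set \<Rightarrow> ('g word \<times> 'g word) set \<Rightarrow> 'g word set monoid" where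
  "presented_group X R =
    \<lparr>carrier = words X // pres_rel X R,
     mult = (\<lambda>A B. \<Union>u\<in>A. \<Union>v\<in>B. pres_rel X R `` {u @ v}),
     one = pres_rel X R `` {[]}\<rparr>"

definition pres_gen :: "'g set \<Rightarrow> ('g word \<times> 'g word) set \<Rightarrow> 'g \<Rightarrow> 'g word set" where
  "pres_gen X R x = pres_rel X R `` {[(x, True)]}"

definition free_group :: "nat \<Rightarrow> nat word set monoid" where
  "free_group n = presented_group {1..n} {}"

definition braid_relations :: "nat \<Rightarrow> (nat word \<times> nat word) set" where
  "braid_relations n =
    {([(i, True), (j, True)], [(j, True), (i, True)]) | i j. 1 \<le> i \<and> i + 2 \<le> j \<and> j < n} \<union>
    {([(i, True), (i + 1, True), (i, True)], [(i + 1, True), (i, True), (i + 1, True)]) | i.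
       1 \<le> i \<and> i + 1 < n}"

definition braid_group :: "nat \<Rightarrow> nat word set monoid" where
  "braid_group n = presented_group {1..<n} (braid_relations n)"


section \<open>The Artin action and the semidirect product\<close>

definition word_inv :: "'g word \<Rightarrow> 'g word" where
  "word_inv w = rev (map (\<lambda>(x, e). (x, \<not> e)) w)"

definition word_subst :: "('g \<Rightarrow> 'h word) \<Rightarrow> 'g word \<Rightarrow> 'h word" where
  "word_subst \<phi> w = concat (map (\<lambda>(x, e). if e then \<phi> x else word_inv (\<phi> x)) w)"

text \<open>The second clause is the automorphism inverse to \<open>\<theta>\<close> of \<open>\<sigma>\<^sub>i\<close>.\<close>

fun artin_letter :: "nat \<times> bool \<Rightarrow> nat \<Rightarrow> nat word" where
  "artin_letter (i, True) j =
    (if j = i then [(i + 1, True)]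
     else if j = i + 1 then [(i + 1, False), (i, True), (i + 1, True)]
     else [(j, True)])"
| "artin_letter (i, False) j =
    (if j = i then [(i, True), (i + 1, True), (i, False)]
     else if j = i + 1 then [(i, True)]
     else [(j, True)])"

definition artin_word :: "nat word \<Rightarrow> nat word \<Rightarrow> nat word" where
  "artin_word b w = foldr (\<lambda>l. word_subst (artin_letter l)) b w"

definition artin_action :: "nat \<Rightarrow> nat word set \<Rightarrow> nat word set \<Rightarrow> nat word set" where
  "artin_action n \<beta> = (\<lambda>A\<in>carrier (free_group n).
     \<Union>b\<in>\<beta>. \<Union>w\<in>A. pres_rel {1..n} {} `` {artin_word b w})"

definition semidirect_product ::
  "('a, 'm) monoid_scheme \<Rightarrow> ('b, 'l) monoid_scheme \<Rightarrow> ('b \<Rightarrow> 'a \<Rightarrow> 'a) \<Rightarrow> ('a \<times> 'b) monoid" where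
  "semidirect_product N H \<theta> =
    \<lparr>carrier = carrier N \<times> carrier H,
     mult = (\<lambda>(x, \<sigma>) (y, \<tau>). (x \<otimes>\<^bsub>N\<^esub> \<theta> \<sigma> y, \<sigma> \<otimes>\<^bsub>H\<^esub> \<tau>)),
     one = (\<one>\<^bsub>N\<^esub>, \<one>\<^bsub>H\<^esub>)\<rparr>"

definition free_braid :: "nat \<Rightarrow> (nat word set \<times> nat word set) monoid" where
  "free_braid n = semidirect_product (free_group n) (braid_group n) (artin_action n)"

definition gen_x :: "nat \<Rightarrow> nat \<Rightarrow> nat word set \<times> nat word set" where
  "gen_x n i = (pres_gen {1..n} {} i, \<one>\<^bsub>braid_group n\<^esub>)"

definition gen_sigma :: "nat \<Rightarrow> nat \<Rightarrow> nat word set \<times> nat word set" where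
  "gen_sigma n i = (\<one>\<^bsub>free_group n\<^esub>, pres_gen {1..<n} (braid_relations n) i)"


section \<open>The groups just defined are as intended\<close>

lemma words_simps [simp]:
  "[] \<in> words X" "(l # w) \<in> words X \<longleftrightarrow> fst l \<in> X \<and> w \<in> words X"
  "u @ v \<in> words X \<longleftrightarrow> u \<in> words X \<and> v \<in> words X"
  by (cases l; auto simp: words_def)+

lemma word_inv_simps [simp]:
  "word_inv [] = []" "word_inv (l # w) = word_inv w @ [(fst l, \<not> snd l)]"
  "word_inv (u @ v) = word_inv v @ word_inv u" "word_inv (word_inv w) = w"
  by (cases l; simp add: word_inv_def rev_map o_def case_prod_beta)+

lemma word_inv_words [simp]: "word_inv w \<in> words X \<longleftrightarrow> w \<in> words X"
  by (induction w) auto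

lemma word_subst_simps [simp]:
  "word_subst \<phi> [] = []"
  "word_subst \<phi> (l # w) =
     (if snd l then \<phi> (fst l) else word_inv (\<phi> (fst l))) @ word_subst \<phi> w"
  "word_subst \<phi> (u @ v) = word_subst \<phi> u @ word_subst \<phi> v"
  by (cases l; simp add: word_subst_def)+

lemma word_subst_words:
  assumes "\<And>x. x \<in> X \<Longrightarrow> \<phi> x \<in> words Y" "w \<in> words X"
  shows "word_subst \<phi> w \<in> words Y"
  using assms(2) by (induction w) (auto simp: assms(1))

lemma word_subst_inv: "word_subst \<phi> (word_inv w) = word_inv (word_subst \<phi> w)"
  by (induction w) auto

lemma pres_rel_words:
  assumes "(u, v) \<in> pres_rel X R" shows "u \<in> words X" "v \<in> words X"
  using assms by (induction rule: pres_rel.induct) auto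

lemma equiv_pres_rel: "equiv (words X) (pres_rel X R)"
proof (rule equivI)
  show "pres_rel X R \<subseteq> words X \<times> words X"
    using pres_rel_words by auto
  show "refl_on (words X) (pres_rel X R)"
    by (rule refl_onI) (rule pres_rel.refl)
  show "sym (pres_rel X R)"
    by (rule symI) (rule pres_rel.sym)
  show "trans (pres_rel X R)"
    by (rule transI) (rule pres_rel.trans)
qed

lemma pres_rel_context:
  assumes "(u, v) \<in> pres_rel X R" "a \<in> words X" "b \<in> words X"
  shows "(a @ u @ b, a @ v @ b) \<in> pres_rel X R"
  using assms
proof (induction rule: pres_rel.induct)
  case (cancel u v x e)
  then show ?case using pres_rel.cancel[of "a @ u" X "v @ b" x e R] by simp
next
  case (relator u v l r)
  then show ?case using pres_rel.relator[of "a @ u" X "v @ b" l r R] by simp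
next
  case (sym u v)
  then show ?case by (simp add: pres_rel.sym)
next
  case (trans u v w)
  then show ?case by (metis pres_rel.trans)
qed (simp add: pres_rel.refl)

lemma pres_rel_append:
  assumes "(u, u') \<in> pres_rel X R" "(v, v') \<in> pres_rel X R"
  shows "(u @ v, u' @ v') \<in> pres_rel X R"
  using pres_rel_context[OF assms(1), of "[]" v] pres_rel_context[OF assms(2), of u' "[]"]
    pres_rel_words[OF assms(1)] pres_rel_words[OF assms(2)]
  by (metis append_Nil append_Nil2 pres_rel.trans words_simps(1))

lemma pres_rel_inv:
  assumes "w \<in> words X" shows "(word_inv w @ w, []) \<in> pres_rel X R"
  using assms
proof (induction w)
  case (Cons l w)
  have "(word_inv w @ [(fst l, \<not> snd l), (fst l, \<not> \<not> snd l)] @ w, word_inv w @ w) \<in> pres_rel X R"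
    using Cons.prems by (intro pres_rel.cancel) auto
  moreover have "(word_inv w @ w, []) \<in> pres_rel X R"
    using Cons by simp
  ultimately show ?case by (simp add: pres_rel.trans)
qed (auto intro: pres_rel.refl)

lemma carrier_presented:
  "A \<in> carrier (presented_group X R) \<longleftrightarrow> (\<exists>w\<in>words X. A = pres_rel X R `` {w})"
  by (auto simp: presented_group_def quotient_def)

lemma pres_class_eq:
  "(u, v) \<in> pres_rel X R \<Longrightarrow> pres_rel X R `` {u} = pres_rel X R `` {v}"
  by (rule equiv_class_eq[OF equiv_pres_rel])

lemma UN2_const:
  assumes "a \<in> A" "b \<in> B" "\<And>x y. x \<in> A \<Longrightarrow> y \<in> B \<Longrightarrow> f x y = c"
  shows "(\<Union>x\<in>A. \<Union>y\<in>B. f x y) = c"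
proof -
  have "(\<Union>x\<in>A. \<Union>y\<in>B. f x y) = (\<Union>x\<in>A. \<Union>y\<in>B. c)"
    using assms(3) by (intro SUP_cong) simp_all
  also have "\<dots> = c" using assms(1,2) by blast
  finally show ?thesis .
qed

lemma mult_presented:
  assumes "u \<in> words X" "v \<in> words X"
  shows "pres_rel X R `` {u} \<otimes>\<^bsub>presented_group X R\<^esub> pres_rel X R `` {v} = pres_rel X R `` {u @ v}"
  unfolding presented_group_def monoid.simps
proof (rule UN2_const)
  show "u \<in> pres_rel X R `` {u}" "v \<in> pres_rel X R `` {v}"
    using assms by (auto intro: pres_rel.refl)
next
  fix u' v' assume "u' \<in> pres_rel X R `` {u}" "v' \<in> pres_rel X R `` {v}"
  then have "(u @ v, u' @ v') \<in> pres_rel X R"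
    by (auto intro: pres_rel_append)
  then show "pres_rel X R `` {u' @ v'} = pres_rel X R `` {u @ v}"
    by (rule pres_class_eq[symmetric])
qed

lemma group_presented: "group (presented_group X R)"
proof (rule groupI, goal_cases)
  case (5 A)
  then obtain w where w: "w \<in> words X" "A = pres_rel X R `` {w}"
    by (auto simp: carrier_presented)
  have "pres_rel X R `` {word_inv w @ w} = pres_rel X R `` {[]}"
    by (rule equiv_class_eq[OF equiv_pres_rel pres_rel_inv[OF w(1)]])
  then have "pres_rel X R `` {word_inv w} \<otimes>\<^bsub>presented_group X R\<^esub> A = \<one>\<^bsub>presented_group X R\<^esub>"
    using w(1) unfolding w(2) by (subst mult_presented) (simp_all add: presented_group_def)
  moreover have "pres_rel X R `` {word_inv w} \<in> carrier (presented_group X R)"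
    using w(1) by (auto simp: carrier_presented)
  ultimately show ?case by blast
next
  case (1 A B)
  then obtain u v where *: "u \<in> words X" "v \<in> words X" "A = pres_rel X R `` {u}" "B = pres_rel X R `` {v}"
    by (auto simp: carrier_presented)
  then have "A \<otimes>\<^bsub>presented_group X R\<^esub> B = pres_rel X R `` {u @ v}"
    by (simp add: mult_presented)
  with * show ?case unfolding carrier_presented by (metis words_simps(3))
next
  case 2
  have "\<one>\<^bsub>presented_group X R\<^esub> = pres_rel X R `` {[]}" by (simp add: presented_group_def)
  then show ?case unfolding carrier_presented by (metis words_simps(1))
next
  case (3 A B C)
  then obtain u v w where "u \<in> words X" "v \<in> words X" "w \<in> words X"
    "A = pres_rel X R `` {u}" "B = pres_rel X R `` {v}" "C = pres_rel X R `` {w}"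
    unfolding carrier_presented by metis
  then show ?case by (simp add: mult_presented)
next
  case (4 A)
  have "\<one>\<^bsub>presented_group X R\<^esub> = pres_rel X R `` {[]}" by (simp add: presented_group_def)
  with 4 show ?case by (auto simp: carrier_presented mult_presented)
qed

fun word_red :: "'g word \<Rightarrow> 'g word" where
  "word_red [] = []"
| "word_red (l # w) =
    (case word_red w of [] \<Rightarrow> [l]
     | m # v \<Rightarrow> if fst m = fst l \<and> snd m \<noteq> snd l then v else l # m # v)"

lemma word_red_rel:
  assumes "w \<in> words X" shows "(w, word_red w) \<in> pres_rel X R"
  using assms
proof (induction w)
  case (Cons l w)
  then have *: "([l] @ w @ [], [l] @ word_red w @ []) \<in> pres_rel X R"
    by (intro pres_rel_context) auto
  show ?case
  proof (cases "word_red w")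
    case (Cons m v)
    have "(l # m # v, v) \<in> pres_rel X R" if "fst m = fst l" "snd m \<noteq> snd l"
    proof -
      have "m = (fst l, \<not> snd l)" using that by (cases m) auto
      moreover have "v \<in> words X" using pres_rel_words(2)[OF *] Cons by simp
      ultimately show ?thesis
        using pres_rel.cancel[of "[]" X v "fst l" "snd l" R] Cons.prems
        by simp
    qed
    then show ?thesis using * pres_rel.trans[OF *] Cons by auto
  qed (use * in auto)
qed (auto intro: pres_rel.refl)

lemma pres_rel_if_word_red:
  assumes "u \<in> words X" "v \<in> words X" "word_red u = word_red v"
  shows "(u, v) \<in> pres_rel X R"
  by (metis assms word_red_rel pres_rel.sym pres_rel.trans)

lemma pres_rel_word_inv:
  assumes "(u, v) \<in> pres_rel X {}"
  shows "(word_inv u, word_inv v) \<in> pres_rel X {}"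
  using assms
proof (induction rule: pres_rel.induct)
  case (cancel u v x e)
  then show ?case
    using pres_rel.cancel[of "word_inv v" X "word_inv u" x e "{}"] by simp
next
  case (sym u v)
  then show ?case by (simp add: pres_rel.sym)
next
  case (trans u v w)
  then show ?case by (metis pres_rel.trans)
qed (simp_all add: pres_rel.refl)

lemma word_subst_rel:
  assumes "\<And>x. x \<in> X \<Longrightarrow> \<phi> x \<in> words Y" "(u, v) \<in> pres_rel X {}"
  shows "(word_subst \<phi> u, word_subst \<phi> v) \<in> pres_rel Y {}"
  using assms(2)
proof (induction rule: pres_rel.induct)
  case (cancel u v x e)
  let ?a = "if e then \<phi> x else word_inv (\<phi> x)"
  have "(word_inv (word_inv ?a) @ word_inv ?a, []) \<in> pres_rel Y {}"
    by (rule pres_rel_inv) (use cancel assms(1) in auto)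
  from pres_rel_context[OF this, of "word_subst \<phi> u" "word_subst \<phi> v"]
  show ?case using cancel.hyps by (auto simp: word_subst_words[OF assms(1)])
next
  case (sym u v)
  then show ?case by (simp add: pres_rel.sym)
next
  case (trans u v w)
  then show ?case by (metis pres_rel.trans)
next
  case (refl w)
  then show ?case by (intro pres_rel.refl word_subst_words assms(1))
qed simp

lemma word_subst_cong_rel:
  assumes "\<And>x. x \<in> X \<Longrightarrow> (\<phi> x, \<psi> x) \<in> pres_rel Y {}" "w \<in> words X"
  shows "(word_subst \<phi> w, word_subst \<psi> w) \<in> pres_rel Y {}"
  using assms(2)
  by (induction w) (auto intro!: pres_rel_append pres_rel_word_inv assms(1) pres_rel.refl)

lemma word_subst_subst:
  "word_subst \<phi> (word_subst \<psi> w) = word_subst (\<lambda>x. word_subst \<phi> (\<psi> x)) w"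
  by (induction w) (auto simp: word_subst_inv)

lemma word_subst_id: "word_subst (\<lambda>x. [(x, True)]) w = w"
  by (induction w) (auto simp: prod_eq_iff)

lemma artin_letter_words:
  assumes "fst l \<in> {1..<n}" "j \<in> {1..n}"
  shows "artin_letter l j \<in> words {1..n}"
  using assms by (cases "(l, j)" rule: artin_letter.cases) auto

lemma artin_word_simps [simp]:
  "artin_word [] w = w"
  "artin_word (l # b) w = word_subst (artin_letter l) (artin_word b w)"
  "artin_word (b @ b') w = artin_word b (artin_word b' w)"
  by (simp_all add: artin_word_def)

lemma artin_word_append: "artin_word b (u @ v) = artin_word b u @ artin_word b v"
  by (induction b) auto

lemma artin_word_words:
  assumes "b \<in> words {1..<n}" "w \<in> words {1..n}"
  shows "artin_word b w \<in> words {1..n}"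
  using assms by (induction b) (auto simp del: One_nat_def intro!: word_subst_words[of "{1..n}"] artin_letter_words)

lemma artin_word_rel:
  assumes "b \<in> words {1..<n}" "(u, v) \<in> pres_rel {1..n} {}"
  shows "(artin_word b u, artin_word b v) \<in> pres_rel {1..n} {}"
  using assms by (induction b) (auto simp del: One_nat_def intro!: word_subst_rel[of "{1..n}"] artin_letter_words)

lemma artin_word_conv_subst:
  "artin_word b w = word_subst (\<lambda>x. artin_word b [(x, True)]) w"
  by (induction b) (auto simp: word_subst_id word_subst_subst)

lemma artin_word_rel_gen:
  assumes "b \<in> words {1..<n}" "b' \<in> words {1..<n}" "w \<in> words {1..n}"
    "\<And>x. x \<in> {1..n} \<Longrightarrow> word_red (artin_word b [(x, True)]) = word_red (artin_word b' [(x, True)])"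
  shows "(artin_word b w, artin_word b' w) \<in> pres_rel {1..n} {}"
  unfolding artin_word_conv_subst[of b w] artin_word_conv_subst[of b' w]
  using assms by (intro word_subst_cong_rel[of "{1..n}"] pres_rel_if_word_red artin_word_words) auto

lemma artin_word_braid_rel:
  assumes "(b, b') \<in> pres_rel {1..<n} (braid_relations n)" "w \<in> words {1..n}"
  shows "(artin_word b w, artin_word b' w) \<in> pres_rel {1..n} {}"
  using assms
proof (induction arbitrary: w rule: pres_rel.induct)
  case (refl b)
  then show ?case by (auto simp del: One_nat_def intro: pres_rel.refl artin_word_words)
next
  case (trans u v v')
  then show ?case by (metis pres_rel.trans)
next
  case (cancel u v x e)
  have "(artin_word [(x, e), (x, \<not> e)] (artin_word v w), artin_word [] (artin_word v w)) \<in> pres_rel {1..n} {}"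
    by (rule artin_word_rel_gen)
      (use cancel in \<open>cases e; auto simp: artin_word_words simp del: One_nat_def\<close>)+
  then show ?case using artin_word_rel[OF cancel(1)] by simp
next
  case (relator u v l r)
  have "(artin_word l (artin_word v w), artin_word r (artin_word v w)) \<in> pres_rel {1..n} {}"
    by (rule artin_word_rel_gen)
      (use relator in \<open>auto simp: artin_word_words braid_relations_def simp del: One_nat_def\<close>)
  then show ?case using artin_word_rel[OF relator(1)] by simp
next
  case (sym u v)
  then show ?case by (simp add: pres_rel.sym)
qed

lemma artin_action_class:
  assumes "b \<in> words {1..<n}" "w \<in> words {1..n}"
  shows "artin_action n (pres_rel {1..<n} (braid_relations n) `` {b}) (pres_rel {1..n} {} `` {w}) =
    pres_rel {1..n} {} `` {artin_word b w}"
proof -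
  have "pres_rel {1..n} {} `` {w} \<in> carrier (free_group n)"
    unfolding free_group_def carrier_presented using assms(2) by blast
  moreover have "(\<Union>b'\<in>pres_rel {1..<n} (braid_relations n) `` {b}. \<Union>w'\<in>pres_rel {1..n} {} `` {w}.
      pres_rel {1..n} {} `` {artin_word b' w'}) = pres_rel {1..n} {} `` {artin_word b w}"
  proof (rule UN2_const)
    show "b \<in> pres_rel {1..<n} (braid_relations n) `` {b}" "w \<in> pres_rel {1..n} {} `` {w}"
      using assms by (blast intro: pres_rel.refl)+
  next
    fix b' w'
    assume "b' \<in> pres_rel {1..<n} (braid_relations n) `` {b}" "w' \<in> pres_rel {1..n} {} `` {w}"
    then have *: "(b, b') \<in> pres_rel {1..<n} (braid_relations n)" "(w, w') \<in> pres_rel {1..n} {}"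
      by auto
    have "(artin_word b w, artin_word b' w) \<in> pres_rel {1..n} {}"
      by (rule artin_word_braid_rel[OF *(1) assms(2)])
    moreover have "(artin_word b' w, artin_word b' w') \<in> pres_rel {1..n} {}"
      by (rule artin_word_rel[OF pres_rel_words(2)[OF *(1)] *(2)])
    ultimately show "pres_rel {1..n} {} `` {artin_word b' w'} = pres_rel {1..n} {} `` {artin_word b w}"
      by (metis pres_class_eq)
  qed
  ultimately show ?thesis unfolding artin_action_def by simp
qed

lemma artin_action_mult:
  assumes "\<beta> \<in> carrier (braid_group n)" "\<gamma> \<in> carrier (braid_group n)" "A \<in> carrier (free_group n)"
  shows "artin_action n (\<beta> \<otimes>\<^bsub>braid_group n\<^esub> \<gamma>) A = artin_action n \<beta> (artin_action n \<gamma> A)"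
proof -
  obtain b c w where "b \<in> words {1..<n}" "c \<in> words {1..<n}" "w \<in> words {1..n}"
    "\<beta> = pres_rel {1..<n} (braid_relations n) `` {b}"
    "\<gamma> = pres_rel {1..<n} (braid_relations n) `` {c}" "A = pres_rel {1..n} {} `` {w}"
    using assms unfolding free_group_def braid_group_def carrier_presented by metis
  then show ?thesis
    unfolding braid_group_def
    by (simp add: mult_presented artin_action_class artin_word_words del: One_nat_def)
qed

lemma artin_action_hom:
  assumes "\<beta> \<in> carrier (braid_group n)"
  shows "artin_action n \<beta> \<in> hom (free_group n) (free_group n)"
proof (rule homI)
  obtain b where b: "b \<in> words {1..<n}" "\<beta> = pres_rel {1..<n} (braid_relations n) `` {b}"
    using assms unfolding braid_group_def carrier_presented by metis
  show "artin_action n \<beta> A \<in> carrier (free_group n)" if A: "A \<in> carrier (free_group n)" for A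
  proof -
    obtain w where w: "w \<in> words {1..n}" "A = pres_rel {1..n} {} `` {w}"
      using A unfolding free_group_def carrier_presented by metis
    show ?thesis
      unfolding b(2) w(2) artin_action_class[OF b(1) w(1)] free_group_def carrier_presented
      using artin_word_words[OF b(1) w(1)] by blast
  qed
  show "artin_action n \<beta> (A \<otimes>\<^bsub>free_group n\<^esub> B) =
      artin_action n \<beta> A \<otimes>\<^bsub>free_group n\<^esub> artin_action n \<beta> B"
    if AB: "A \<in> carrier (free_group n)" "B \<in> carrier (free_group n)" for A B
  proof -
    obtain v w where "v \<in> words {1..n}" "w \<in> words {1..n}"
      "A = pres_rel {1..n} {} `` {v}" "B = pres_rel {1..n} {} `` {w}"
      using AB unfolding free_group_def carrier_presented by metis
    with b show ?thesis
      unfolding free_group_def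
      by (simp add: mult_presented artin_action_class artin_word_words artin_word_append del: One_nat_def)
  qed
qed

lemma group_free_group: "group (free_group n)"
  by (simp add: free_group_def group_presented)

lemma group_braid_group: "group (braid_group n)"
  by (simp add: braid_group_def group_presented)

lemma artin_action_one:
  assumes "A \<in> carrier (free_group n)"
  shows "artin_action n \<one>\<^bsub>braid_group n\<^esub> A = A"
proof -
  have "\<one>\<^bsub>braid_group n\<^esub> = pres_rel {1..<n} (braid_relations n) `` {[]}"
    by (simp add: braid_group_def presented_group_def)
  moreover from assms obtain w where "w \<in> words {1..n}" "A = pres_rel {1..n} {} `` {w}"
    unfolding free_group_def carrier_presented by blast
  ultimately show ?thesis by (simp add: artin_action_class del: One_nat_def)
qed

lemma artin_action_auto:
  assumes "\<beta> \<in> carrier (braid_group n)"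
  shows "artin_action n \<beta> \<in> auto (free_group n)"
proof -
  interpret B: group "braid_group n" by (rule group_braid_group)
  have inv: "inv\<^bsub>braid_group n\<^esub> \<beta> \<in> carrier (braid_group n)" using assms by simp
  have "bij_betw (artin_action n \<beta>) (carrier (free_group n)) (carrier (free_group n))"
    by (rule bij_betw_byWitness[where f' = "artin_action n (inv\<^bsub>braid_group n\<^esub> \<beta>)"])
      (use hom_in_carrier[OF artin_action_hom[OF assms]] hom_in_carrier[OF artin_action_hom[OF inv]]
        assms inv in \<open>auto simp: artin_action_one simp flip: artin_action_mult\<close>)
  moreover have "artin_action n \<beta> \<in> extensional (carrier (free_group n))"
    by (simp add: artin_action_def)
  ultimately show ?thesis
    using artin_action_hom[OF assms] by (simp add: auto_def Bij_def)
qed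

theorem artin_action_AutoGroup:
  "artin_action n \<in> hom (braid_group n) (AutoGroup (free_group n))"
proof (rule homI)
  fix \<beta> \<gamma> assume *: "\<beta> \<in> carrier (braid_group n)" "\<gamma> \<in> carrier (braid_group n)"
  interpret B: group "braid_group n" by (rule group_braid_group)
  have "artin_action n (\<beta> \<otimes>\<^bsub>braid_group n\<^esub> \<gamma>) =
      compose (carrier (free_group n)) (artin_action n \<beta>) (artin_action n \<gamma>)"
  proof (rule extensionalityI[of _ "carrier (free_group n)"])
    show "artin_action n (\<beta> \<otimes>\<^bsub>braid_group n\<^esub> \<gamma>) \<in> extensional (carrier (free_group n))"
      by (simp add: artin_action_def)
  qed (use * in \<open>auto simp: artin_action_mult compose_def\<close>)
  then show "artin_action n (\<beta> \<otimes>\<^bsub>braid_group n\<^esub> \<gamma>) =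
      artin_action n \<beta> \<otimes>\<^bsub>AutoGroup (free_group n)\<^esub> artin_action n \<gamma>"
    using artin_action_auto[OF *(1)] artin_action_auto[OF *(2)]
    by (simp add: AutoGroup_def BijGroup_def auto_def)
qed (simp add: AutoGroup_def artin_action_auto)

theorem group_free_braid: "group (free_braid n)"
proof -
  interpret F: group "free_group n" by (rule group_free_group)
  interpret B: group "braid_group n" by (rule group_braid_group)
  note act = artin_action_hom[THEN hom_in_carrier] artin_action_hom[THEN hom_mult]
    artin_action_mult artin_action_one
  have [simp]: "artin_action n \<beta> \<one>\<^bsub>free_group n\<^esub> = \<one>\<^bsub>free_group n\<^esub>" if "\<beta> \<in> carrier (braid_group n)" for \<beta>
    using hom_one[OF artin_action_hom[OF that]] F.is_group by simp
  show ?thesis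
  proof (rule groupI)
    fix a assume "a \<in> carrier (free_braid n)"
    then obtain x \<sigma> where a: "a = (x, \<sigma>)" "x \<in> carrier (free_group n)" "\<sigma> \<in> carrier (braid_group n)"
      by (auto simp: free_braid_def semidirect_product_def)
    define c where "c = (artin_action n (inv\<^bsub>braid_group n\<^esub> \<sigma>) (inv\<^bsub>free_group n\<^esub> x), inv\<^bsub>braid_group n\<^esub> \<sigma>)"
    have "c \<in> carrier (free_braid n)" "c \<otimes>\<^bsub>free_braid n\<^esub> a = \<one>\<^bsub>free_braid n\<^esub>"
      using a by (simp_all add: c_def free_braid_def semidirect_product_def act flip: artin_action_hom[THEN hom_mult])
    then show "\<exists>c\<in>carrier (free_braid n). c \<otimes>\<^bsub>free_braid n\<^esub> a = \<one>\<^bsub>free_braid n\<^esub>" by blast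
  qed (auto simp: free_braid_def semidirect_product_def act F.m_assoc B.m_assoc)
qed

text \<open>The relation \<open>\<sigma>x\<sigma>\<inverse> = \<theta>\<^sub>\<sigma>(x)\<close>, with the inverse moved to the other side.\<close>

theorem free_braid_conj:
  assumes "\<sigma> \<in> carrier (braid_group n)" "x \<in> carrier (free_group n)"
  shows "(\<one>\<^bsub>free_group n\<^esub>, \<sigma>) \<otimes>\<^bsub>free_braid n\<^esub> (x, \<one>\<^bsub>braid_group n\<^esub>) =
    (artin_action n \<sigma> x, \<one>\<^bsub>braid_group n\<^esub>) \<otimes>\<^bsub>free_braid n\<^esub> (\<one>\<^bsub>free_group n\<^esub>, \<sigma>)"
proof -
  interpret F: group "free_group n" by (rule group_free_group)
  interpret B: group "braid_group n" by (rule group_braid_group)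
  show ?thesis
    using assms hom_in_carrier[OF artin_action_hom[OF assms(1)]]
    by (simp add: free_braid_def semidirect_product_def artin_action_one)
qed


section \<open>Representations, the Long--Moody and Katz--Long--Moody constructions\<close>

definition GL :: "('k::field \<Rightarrow> 'v::ab_group_add \<Rightarrow> 'v) \<Rightarrow> ('v \<Rightarrow> 'v) monoid" where
  "GL scale =
    \<lparr>carrier = {f. Vector_Spaces.linear scale scale f \<and> bij f}, mult = (\<circ>), one = id\<rparr>"

text \<open>\<open>V\<^sup>n\<close> consists of the functions supported on \<open>{1..n}\<close>, under the pointwise operations.
  Its operators are block matrices whose entries are operators on \<open>V\<close>.\<close>

definition power_space :: "nat \<Rightarrow> (nat \<Rightarrow> 'v::ab_group_add) set" where
  "power_space n = {w. \<forall>j. j \<notin> {1..n} \<longrightarrow> w j = 0}"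

definition fscale :: "('k \<Rightarrow> 'v \<Rightarrow> 'v) \<Rightarrow> 'k \<Rightarrow> (nat \<Rightarrow> 'v) \<Rightarrow> nat \<Rightarrow> 'v" where
  "fscale scale c w = (\<lambda>j. scale c (w j))"

definition block_apply ::
  "nat \<Rightarrow> (nat \<Rightarrow> nat \<Rightarrow> 'v \<Rightarrow> 'v::ab_group_add) \<Rightarrow> (nat \<Rightarrow> 'v) \<Rightarrow> nat \<Rightarrow> 'v" where
  "block_apply n M w = (\<lambda>p. if p \<in> {1..n} then \<Sum>q = 1..n. M p q (w q) else 0)"

definition LM_x ::
  "('k::field \<Rightarrow> 'v::ab_group_add \<Rightarrow> 'v) \<Rightarrow> nat \<Rightarrow> (nat word set \<times> nat word set \<Rightarrow> 'v \<Rightarrow> 'v)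
    \<Rightarrow> 'k \<Rightarrow> nat \<Rightarrow> (nat \<Rightarrow> 'v) \<Rightarrow> nat \<Rightarrow> 'v" where
  "LM_x scale n rho lam i =
    (let g = (\<lambda>j. rho (gen_x n j)) in
     block_apply n (\<lambda>p q v.
       if p = i then
         (if q < i then scale lam (g q v - v)
          else if q = i then scale lam (g i v)
          else g q v - v)
       else if p = q then v else 0))"

definition LM_sigma ::
  "nat \<Rightarrow> (nat word set \<times> nat word set \<Rightarrow> 'v \<Rightarrow> 'v)
    \<Rightarrow> nat \<Rightarrow> (nat \<Rightarrow> 'v::ab_group_add) \<Rightarrow> nat \<Rightarrow> 'v" where
  "LM_sigma n rho i =
    (let g = (\<lambda>j. rho (gen_x n j)); s = rho (gen_sigma n i) in
     block_apply n (\<lambda>p q v. if p = q then s v else 0) \<circ>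
     block_apply n (\<lambda>p q v.
       if p = i \<and> q = i then 0
       else if p = i \<and> q = i + 1 then g i v
       else if p = i + 1 \<and> q = i then v
       else if p = i + 1 \<and> q = i + 1 then v - g (i + 1) v
       else if p = q then v else 0))"

definition KLM_K ::
  "nat \<Rightarrow> (nat word set \<times> nat word set \<Rightarrow> 'v \<Rightarrow> 'v::ab_group_add) \<Rightarrow> (nat \<Rightarrow> 'v) set" where
  "KLM_K n rho = {w \<in> power_space n. \<forall>j\<in>{1..n}. rho (gen_x n j) (w j) - w j = 0}"

definition KLM_L ::
  "('k::field \<Rightarrow> 'v::ab_group_add \<Rightarrow> 'v) \<Rightarrow> nat \<Rightarrow> (nat word set \<times> nat word set \<Rightarrow> 'v \<Rightarrow> 'v)
    \<Rightarrow> 'k \<Rightarrow> (nat \<Rightarrow> 'v) set" where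
  "KLM_L scale n rho lam = {w \<in> power_space n. \<forall>j\<in>{1..n}. LM_x scale n rho lam j w - w = 0}"

text \<open>Quotient of a space \<open>U\<close> by a subspace \<open>W\<close>, realised by cosets; the operations are lifted
  from representatives.\<close>

definition quot_space :: "'a::ab_group_add set \<Rightarrow> 'a set \<Rightarrow> 'a set set" where
  "quot_space U W = (\<lambda>v. v +o W) ` U"

definition quot_map :: "'a::ab_group_add set \<Rightarrow> ('a \<Rightarrow> 'a) \<Rightarrow> 'a set \<Rightarrow> 'a set" where
  "quot_map W f A = (\<Union>v\<in>A. f v +o W)"

definition quot_map2 :: "'a::ab_group_add set \<Rightarrow> ('a \<Rightarrow> 'a \<Rightarrow> 'a) \<Rightarrow> 'a set \<Rightarrow> 'a set \<Rightarrow> 'a set" where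
  "quot_map2 W f A B = (\<Union>v\<in>A. \<Union>w\<in>B. f v w +o W)"

definition KLM_sub ::
  "('k::field \<Rightarrow> 'v::ab_group_add \<Rightarrow> 'v) \<Rightarrow> nat \<Rightarrow> (nat word set \<times> nat word set \<Rightarrow> 'v \<Rightarrow> 'v)
    \<Rightarrow> 'k \<Rightarrow> (nat \<Rightarrow> 'v) set" where
  "KLM_sub scale n rho lam = KLM_K n rho + KLM_L scale n rho lam"

definition KLM_sigma ::
  "('k::field \<Rightarrow> 'v::ab_group_add \<Rightarrow> 'v) \<Rightarrow> nat \<Rightarrow> (nat word set \<times> nat word set \<Rightarrow> 'v \<Rightarrow> 'v)
    \<Rightarrow> 'k \<Rightarrow> nat \<Rightarrow> (nat \<Rightarrow> 'v) set \<Rightarrow> (nat \<Rightarrow> 'v) set" where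
  "KLM_sigma scale n rho lam i = quot_map (KLM_sub scale n rho lam) (LM_sigma n rho i)"

end

theory Submission
  imports Defs
begin

text \<open>
  All statements about the \<open>T\<^sub>i\<close> become statements about the \<open>X\<^sub>i\<close> modulo \<open>W = K + L\<close> as soon as
  the \<open>T\<^sub>i\<close> really are the operators induced by the \<open>X\<^sub>i\<close> on \<open>V\<^sup>n / W\<close>, that is, as soon as \<open>W\<close> is a
  subspace stable under every \<open>\<rho>\<^sup>L\<^sup>M(\<sigma>\<^sub>i)\<close> (lemma \<open>LM_sigma_KLM_sub\<close>). A polynomial relation between
  induced operators then holds exactly when the same polynomial in the \<open>X\<^sub>i\<close> maps \<open>V\<^sup>n\<close> into \<open>W\<close>.
  For the Temperley--Lieb relations this is the asserted equivalence. The quadratic relation is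
  the Hecke relation in another form, because
  \<open>(1 - X)\<^sup>2 - (1 + \<mu>)(1 - X) = (X - 1)(X + \<mu>)\<close>. Far commutation holds already for the
  \<open>X\<^sub>i\<close> on \<open>V\<^sup>n\<close> (lemma \<open>LM_sigma_commute\<close>).

  The stability of \<open>W\<close> is where the group enters. The relations of \<open>F\<^sub>n \<rtimes> B\<^sub>n\<close> give
  \<open>s\<^sub>i g\<^sub>i = g\<^sub>i\<^sub>+\<^sub>1 s\<^sub>i\<close>, \<open>g\<^sub>i s\<^sub>i g\<^sub>i = s\<^sub>i g\<^sub>i g\<^sub>i\<^sub>+\<^sub>1\<close> and \<open>s\<^sub>i g\<^sub>j = g\<^sub>j s\<^sub>i\<close> for the other \<open>j\<close>, while
  \<open>\<rho>\<^sup>L\<^sup>M(\<sigma>\<^sub>i)\<close> sends \<open>w\<close> to the vector with entries \<open>s\<^sub>i g\<^sub>i w\<^sub>i\<^sub>+\<^sub>1\<close> in place \<open>i\<close>,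
  \<open>s\<^sub>i (w\<^sub>i + w\<^sub>i\<^sub>+\<^sub>1 - g\<^sub>i\<^sub>+\<^sub>1 w\<^sub>i\<^sub>+\<^sub>1)\<close> in place \<open>i + 1\<close>, and \<open>s\<^sub>i w\<^sub>j\<close> elsewhere. For \<open>K\<close> the invariance
  is immediate from this. For \<open>L\<close> it becomes so after \<open>L\<close> is rewritten, using \<open>\<lambda> \<noteq> 1\<close>, as
  the set of \<open>w\<close> with \<open>w\<^sub>j = g\<^sub>j\<^sub>+\<^sub>1 w\<^sub>j\<^sub>+\<^sub>1\<close> for \<open>1 \<le> j < n\<close> and \<open>\<lambda> g\<^sub>1 w\<^sub>1 = w\<^sub>n\<close> (lemma
  \<open>KLM_L_iff\<close>): a cyclic chain of conditions on neighbouring entries.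
\<close>

section \<open>Operators on a quotient group\<close>

locale additive_subgroup =
  fixes W :: "'a::ab_group_add set"
  assumes zero_mem: "0 \<in> W"
    and diff_mem: "x \<in> W \<Longrightarrow> y \<in> W \<Longrightarrow> x - y \<in> W"
begin

lemma minus_mem: "x \<in> W \<Longrightarrow> - x \<in> W"
  using diff_mem[OF zero_mem] by simp

lemma add_mem: "x \<in> W \<Longrightarrow> y \<in> W \<Longrightarrow> x + y \<in> W"
  using diff_mem[OF _ minus_mem] by simp

lemma mem_coset_iff: "w \<in> v +o W \<longleftrightarrow> w - v \<in> W"
  by (auto simp: elt_set_plus_def intro!: bexI[of _ "w - v"])

lemma coset_eq_iff: "v +o W = w +o W \<longleftrightarrow> v - w \<in> W"
proof
  assume "v +o W = w +o W"
  moreover have "v \<in> v +o W" by (simp add: mem_coset_iff zero_mem)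
  ultimately show "v - w \<in> W" by (simp add: mem_coset_iff)
next
  assume vw: "v - w \<in> W"
  show "v +o W = w +o W"
  proof (rule Set.set_eqI)
    fix u
    show "u \<in> v +o W \<longleftrightarrow> u \<in> w +o W"
      using add_mem[OF _ vw, of "u - v"] diff_mem[OF _ vw, of "u - w"]
      by (auto simp: mem_coset_iff)
  qed
qed

lemma coset_eq_self_iff: "v +o W = W \<longleftrightarrow> v \<in> W"
  using coset_eq_iff[of v 0] by (simp add: set_zero_plus)

lemma quot_map_coset:
  assumes "additive f" "f ` W \<subseteq> W"
  shows "quot_map W f (v +o W) = f v +o W"
proof -
  have "f u +o W = f v +o W" if "u \<in> v +o W" for u
    using that assms(2) unfolding coset_eq_iff mem_coset_iff
    by (metis additive.diff[OF assms(1)] image_subset_iff)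
  moreover have "v \<in> v +o W" by (simp add: mem_coset_iff zero_mem)
  ultimately show ?thesis unfolding quot_map_def by blast
qed

lemma quot_map2_add_coset: "quot_map2 W (+) (v +o W) (w +o W) = (v + w) +o W"
  unfolding quot_map2_def
proof (rule UN2_const)
  show "v \<in> v +o W" "w \<in> w +o W" by (simp_all add: mem_coset_iff zero_mem)
next
  fix v' w' assume "v' \<in> v +o W" "w' \<in> w +o W"
  then have "(v' - v) + (w' - w) \<in> W"
    unfolding mem_coset_iff by (rule add_mem)
  moreover have "(v' - v) + (w' - w) = (v' + w') - (v + w)" by simp
  ultimately show "(v' + w') +o W = (v + w) +o W" by (simp only: coset_eq_iff)
qed

lemma quot_map2_diff_coset: "quot_map2 W (-) (v +o W) (w +o W) = (v - w) +o W"
  unfolding quot_map2_def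
proof (rule UN2_const)
  show "v \<in> v +o W" "w \<in> w +o W" by (simp_all add: mem_coset_iff zero_mem)
next
  fix v' w' assume "v' \<in> v +o W" "w' \<in> w +o W"
  then have "(v' - v) - (w' - w) \<in> W"
    unfolding mem_coset_iff by (rule diff_mem)
  moreover have "(v' - v) - (w' - w) = (v' - w') - (v - w)" by simp
  ultimately show "(v' - w') +o W = (v - w) +o W" by (simp only: coset_eq_iff)
qed

end


section \<open>Relations among the generators\<close>

lemma pres_gen_carrier:
  assumes "x \<in> X" shows "pres_gen X R x \<in> carrier (presented_group X R)"
  unfolding carrier_presented pres_gen_def using assms by (intro bexI[of _ "[(x, True)]"]) auto

lemma gen_x_carrier:
  assumes "j \<in> {1..n}" shows "gen_x n j \<in> carrier (free_braid n)"
  using pres_gen_carrier[OF assms, of "{}"] group.is_monoid[OF group_braid_group, of n]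
  by (simp add: gen_x_def free_braid_def semidirect_product_def free_group_def monoid.one_closed)

lemma gen_sigma_carrier:
  assumes "i \<in> {1..<n}" shows "gen_sigma n i \<in> carrier (free_braid n)"
  using pres_gen_carrier[OF assms, of "braid_relations n"]
    group.is_monoid[OF group_free_group, of n]
  by (simp add: gen_sigma_def free_braid_def semidirect_product_def braid_group_def
      monoid.one_closed)

lemma free_braid_mult_free:
  assumes "A \<in> carrier (free_group n)" "B \<in> carrier (free_group n)"
  shows "(A, \<one>\<^bsub>braid_group n\<^esub>) \<otimes>\<^bsub>free_braid n\<^esub> (B, \<one>\<^bsub>braid_group n\<^esub>)
    = (A \<otimes>\<^bsub>free_group n\<^esub> B, \<one>\<^bsub>braid_group n\<^esub>)"
  using assms group.is_monoid[OF group_braid_group, of n]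
  by (simp add: free_braid_def semidirect_product_def artin_action_one monoid.l_one
      monoid.one_closed)

lemma free_braid_mult_braid:
  assumes "\<beta> \<in> carrier (braid_group n)"
  shows "(\<one>\<^bsub>free_group n\<^esub>, \<beta>) \<otimes>\<^bsub>free_braid n\<^esub> (\<one>\<^bsub>free_group n\<^esub>, \<gamma>)
    = (\<one>\<^bsub>free_group n\<^esub>, \<beta> \<otimes>\<^bsub>braid_group n\<^esub> \<gamma>)"
  using hom_one[OF artin_action_hom[OF assms] group_free_group group_free_group]
    group.is_monoid[OF group_free_group, of n]
  by (simp add: free_braid_def semidirect_product_def monoid.l_one monoid.one_closed)

lemma gen_sigma_gen_x:
  assumes "i \<in> {1..<n}" "j \<in> {1..n}"
  shows "gen_sigma n i \<otimes>\<^bsub>free_braid n\<^esub> gen_x n j =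
    (pres_rel {1..n} {} `` {artin_letter (i, True) j}, \<one>\<^bsub>braid_group n\<^esub>)
      \<otimes>\<^bsub>free_braid n\<^esub> gen_sigma n i"
proof -
  have "artin_action n (pres_gen {1..<n} (braid_relations n) i) (pres_gen {1..n} {} j)
      = pres_rel {1..n} {} `` {artin_letter (i, True) j}"
    unfolding pres_gen_def using assms by (subst artin_action_class) auto
  then show ?thesis
    unfolding gen_sigma_def gen_x_def
    using free_braid_conj[of "pres_gen {1..<n} (braid_relations n) i" n "pres_gen {1..n} {} j"]
      pres_gen_carrier[OF assms(1), of "braid_relations n"] pres_gen_carrier[OF assms(2), of "{}"]
    by (simp add: braid_group_def free_group_def)
qed

lemma gen_sigma_gen_x_same:
  assumes "i \<in> {1..<n}"
  shows "gen_sigma n i \<otimes>\<^bsub>free_braid n\<^esub> gen_x n i = gen_x n (i + 1) \<otimes>\<^bsub>free_braid n\<^esub> gen_sigma n i"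
  using gen_sigma_gen_x[OF assms, of i] assms by (simp add: gen_x_def pres_gen_def)

lemma gen_sigma_gen_x_other:
  assumes "i \<in> {1..<n}" "j \<in> {1..n}" "j \<noteq> i" "j \<noteq> i + 1"
  shows "gen_sigma n i \<otimes>\<^bsub>free_braid n\<^esub> gen_x n j = gen_x n j \<otimes>\<^bsub>free_braid n\<^esub> gen_sigma n i"
  using gen_sigma_gen_x[OF assms(1,2)] assms(3,4) by (simp add: gen_x_def pres_gen_def)

text \<open>The Artin action gives \<open>\<sigma>\<^sub>i x\<^sub>i\<^sub>+\<^sub>1 = x\<^sub>i\<^sub>+\<^sub>1\<inverse> x\<^sub>i x\<^sub>i\<^sub>+\<^sub>1 \<sigma>\<^sub>i\<close>. The extra factor \<open>x\<^sub>i\<^sub>+\<^sub>1\<close> on the left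
  clears the inverse, so that only the operators \<open>g\<^sub>j\<close> and \<open>s\<^sub>i\<close> themselves appear after \<open>\<rho>\<close> is
  applied.\<close>

lemma gen_sigma_gen_x_succ:
  assumes "i \<in> {1..<n}"
  shows "gen_x n (i + 1) \<otimes>\<^bsub>free_braid n\<^esub> (gen_sigma n i \<otimes>\<^bsub>free_braid n\<^esub> gen_x n (i + 1)) =
    (gen_x n i \<otimes>\<^bsub>free_braid n\<^esub> gen_x n (i + 1)) \<otimes>\<^bsub>free_braid n\<^esub> gen_sigma n i"
proof -
  interpret G: group "free_braid n" by (rule group_free_braid)
  let ?cl = "\<lambda>w. pres_rel {1..n} {} `` {w}"
  let ?c = "[(i + 1, False), (i, True), (i + 1, True)]"
  have ii: "i \<in> {1..n}" "i + 1 \<in> {1..n}" using assms by auto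
  have carr: "?cl w \<in> carrier (free_group n)" if "w \<in> words {1..n}" for w
    using that unfolding free_group_def carrier_presented by blast
  have c: "?c \<in> words {1..n}" using ii by simp
  have "([] @ [(i + 1, True), (i + 1, \<not> True)] @ [(i, True), (i + 1, True)],
      [] @ [(i, True), (i + 1, True)]) \<in> pres_rel {1..n} {}"
    using ii by (intro pres_rel.cancel) auto
  then have "?cl ([(i + 1, True)] @ ?c) = ?cl ([(i, True)] @ [(i + 1, True)])"
    by (intro pres_class_eq) simp
  then have "?cl [(i + 1, True)] \<otimes>\<^bsub>free_group n\<^esub> ?cl ?c
      = ?cl [(i, True)] \<otimes>\<^bsub>free_group n\<^esub> ?cl [(i + 1, True)]"
    unfolding free_group_def using ii c
    by (subst (1 2) mult_presented) (auto simp del: One_nat_def)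
  then have eq: "gen_x n (i + 1) \<otimes>\<^bsub>free_braid n\<^esub> (?cl ?c, \<one>\<^bsub>braid_group n\<^esub>)
      = gen_x n i \<otimes>\<^bsub>free_braid n\<^esub> gen_x n (i + 1)"
    unfolding gen_x_def pres_gen_def
    using carr[OF c] carr[of "[(i, True)]"] carr[of "[(i + 1, True)]"] ii
    by (simp add: free_braid_mult_free del: One_nat_def)
  have cc: "(?cl ?c, \<one>\<^bsub>braid_group n\<^esub>) \<in> carrier (free_braid n)"
    using carr[OF c] group.is_monoid[OF group_braid_group, of n]
    by (simp add: free_braid_def semidirect_product_def monoid.one_closed)
  have "gen_sigma n i \<otimes>\<^bsub>free_braid n\<^esub> gen_x n (i + 1)
      = (?cl ?c, \<one>\<^bsub>braid_group n\<^esub>) \<otimes>\<^bsub>free_braid n\<^esub> gen_sigma n i"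
    using gen_sigma_gen_x[OF assms ii(2)] by simp
  then show ?thesis
    using eq G.m_assoc[OF gen_x_carrier[OF ii(2)] cc gen_sigma_carrier[OF assms]] by simp
qed

lemma gen_sigma_commute:
  assumes "i \<in> {1..<n}" "j \<in> {1..<n}" "i + 2 \<le> j"
  shows "gen_sigma n i \<otimes>\<^bsub>free_braid n\<^esub> gen_sigma n j = gen_sigma n j \<otimes>\<^bsub>free_braid n\<^esub> gen_sigma n i"
proof -
  let ?R = "pres_rel {1..<n} (braid_relations n)"
  have "([(i, True), (j, True)], [(j, True), (i, True)]) \<in> braid_relations n"
    using assms by (auto simp: braid_relations_def)
  then have "([] @ [(i, True), (j, True)] @ [], [] @ [(j, True), (i, True)] @ []) \<in> ?R"
    using assms by (intro pres_rel.relator) auto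
  then have "?R `` {[(i, True)] @ [(j, True)]} = ?R `` {[(j, True)] @ [(i, True)]}"
    by (intro pres_class_eq) simp
  then have "pres_gen {1..<n} (braid_relations n) i \<otimes>\<^bsub>braid_group n\<^esub> pres_gen {1..<n} (braid_relations n) j
      = pres_gen {1..<n} (braid_relations n) j \<otimes>\<^bsub>braid_group n\<^esub> pres_gen {1..<n} (braid_relations n) i"
    unfolding pres_gen_def braid_group_def using assms
    by (subst (1 2) mult_presented) (auto simp del: One_nat_def)
  then show ?thesis
    unfolding gen_sigma_def
    using pres_gen_carrier[OF assms(1), of "braid_relations n"]
      pres_gen_carrier[OF assms(2), of "braid_relations n"]
    by (simp add: free_braid_mult_braid braid_group_def)
qed


section \<open>The Long--Moody operators\<close>

locale free_braid_rep = vector_space scale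
  for scale :: "'k::field \<Rightarrow> 'v::ab_group_add \<Rightarrow> 'v" +
  fixes n :: nat and rho :: "nat word set \<times> nat word set \<Rightarrow> 'v \<Rightarrow> 'v"
  assumes rho: "rho \<in> hom (free_braid n) (GL scale)"
begin

abbreviation g :: "nat \<Rightarrow> 'v \<Rightarrow> 'v" where "g j \<equiv> rho (gen_x n j)"
abbreviation s :: "nat \<Rightarrow> 'v \<Rightarrow> 'v" where "s i \<equiv> rho (gen_sigma n i)"

lemma rho_linear: "x \<in> carrier (free_braid n) \<Longrightarrow> Vector_Spaces.linear scale scale (rho x)"
  using hom_in_carrier[OF rho] by (simp add: GL_def)

lemma rho_mult:
  assumes "x \<in> carrier (free_braid n)" "y \<in> carrier (free_braid n)"
  shows "rho (x \<otimes>\<^bsub>free_braid n\<^esub> y) v = rho x (rho y v)"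
  using hom_mult[OF rho assms] by (simp add: GL_def)

lemma g_linear: "j \<in> {1..n} \<Longrightarrow> Vector_Spaces.linear scale scale (g j)"
  by (rule rho_linear[OF gen_x_carrier])

lemma s_linear: "i \<in> {1..<n} \<Longrightarrow> Vector_Spaces.linear scale scale (s i)"
  by (rule rho_linear[OF gen_sigma_carrier])

lemmas g_hom = g_linear[THEN Vector_Spaces.linear.axioms(3)]
lemmas s_hom = s_linear[THEN Vector_Spaces.linear.axioms(3)]

lemmas g_simps = g_hom[THEN module_hom.add] g_hom[THEN module_hom.diff]
  g_hom[THEN module_hom.zero] g_hom[THEN module_hom.scale]
lemmas s_simps = s_hom[THEN module_hom.add] s_hom[THEN module_hom.diff]
  s_hom[THEN module_hom.zero] s_hom[THEN module_hom.scale]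

lemma s_g_same:
  assumes "i \<in> {1..<n}"
  shows "s i (g i v) = g (i + 1) (s i v)"
proof -
  have "i \<in> {1..n}" "i + 1 \<in> {1..n}" using assms by auto
  then show ?thesis
    using arg_cong[OF gen_sigma_gen_x_same[OF assms], of "\<lambda>x. rho x v"] assms
    by (simp add: rho_mult gen_x_carrier gen_sigma_carrier)
qed

lemma s_g_other:
  assumes "i \<in> {1..<n}" "j \<in> {1..n}" "j \<noteq> i" "j \<noteq> i + 1"
  shows "s i (g j v) = g j (s i v)"
  using arg_cong[OF gen_sigma_gen_x_other[OF assms], of "\<lambda>x. rho x v"] assms
  by (simp add: rho_mult gen_x_carrier gen_sigma_carrier)

text \<open>The relation for \<open>\<sigma>\<^sub>i x\<^sub>i\<^sub>+\<^sub>1\<close> reads \<open>g\<^sub>i\<^sub>+\<^sub>1 s\<^sub>i g\<^sub>i\<^sub>+\<^sub>1 = g\<^sub>i g\<^sub>i\<^sub>+\<^sub>1 s\<^sub>i\<close>; replacing each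
  \<open>g\<^sub>i\<^sub>+\<^sub>1 s\<^sub>i\<close> by \<open>s\<^sub>i g\<^sub>i\<close> yields the form in which it acts on the \<open>i\<close>-th entry of
  \<open>\<rho>\<^sup>L\<^sup>M(\<sigma>\<^sub>i) w\<close>.\<close>

lemma s_g_g:
  assumes "i \<in> {1..<n}"
  shows "s i (g i (g (i + 1) v)) = g i (s i (g i v))"
proof -
  interpret G: group "free_braid n" by (rule group_free_braid)
  have "i \<in> {1..n}" "i + 1 \<in> {1..n}" using assms by auto
  then have "g (i + 1) (s i (g (i + 1) v)) = g i (g (i + 1) (s i v))"
    using arg_cong[OF gen_sigma_gen_x_succ[OF assms], of "\<lambda>x. rho x v"] assms
    by (simp add: rho_mult gen_x_carrier gen_sigma_carrier del: One_nat_def)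
  then show ?thesis by (simp add: s_g_same[OF assms])
qed

lemma s_commute:
  assumes "i \<in> {1..<n}" "j \<in> {1..<n}" "i + 2 \<le> j"
  shows "s i (s j v) = s j (s i v)"
  using arg_cong[OF gen_sigma_commute[OF assms], of "\<lambda>x. rho x v"] assms
  by (simp add: rho_mult gen_sigma_carrier)

lemma LM_sigma_apply:
  assumes i: "i \<in> {1..<n}"
  shows "LM_sigma n rho i w p =
    (if p \<notin> {1..n} then 0
     else if p = i then s i (g i (w (i + 1)))
     else if p = i + 1 then s i (w i + w (i + 1) - g (i + 1) (w (i + 1)))
     else s i (w p))"
proof -
  define R where "R = (\<lambda>p q v. if p = i \<and> q = i then 0
       else if p = i \<and> q = i + 1 then g i v
       else if p = i + 1 \<and> q = i then v
       else if p = i + 1 \<and> q = i + 1 then v - g (i + 1) v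
       else if p = q then v else 0)"
  have ii: "i \<in> {1..n}" "i + 1 \<in> {1..n}" using i by auto
  have R: "(\<Sum>q = 1..n. R p q (w q)) =
    (if p = i then g i (w (i + 1))
     else if p = i + 1 then w i + w (i + 1) - g (i + 1) (w (i + 1))
     else w p)" if p: "p \<in> {1..n}"
  proof -
    consider "p = i" | "p = i + 1" | "p \<noteq> i" "p \<noteq> i + 1" by blast
    then show ?thesis
    proof cases
      case 1
      then have "(\<Sum>q = 1..n. R p q (w q))
          = (\<Sum>q = 1..n. if q = i + 1 then g i (w q) else 0)"
        by (intro sum.cong) (auto simp: R_def)
      then show ?thesis using 1 ii by (simp del: One_nat_def)
    next
      case 2
      then have "(\<Sum>q = 1..n. R p q (w q)) = (\<Sum>q = 1..n.
          (if q = i then w q else 0) + (if q = i + 1 then w q - g (i + 1) (w q) else 0))"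
        by (intro sum.cong) (auto simp: R_def)
      then show ?thesis using 2 ii by (simp add: sum.distrib del: One_nat_def)
    next
      case 3
      then have "(\<Sum>q = 1..n. R p q (w q)) = (\<Sum>q = 1..n. if q = p then w q else 0)"
        by (intro sum.cong) (auto simp: R_def)
      then show ?thesis using 3 p by (simp del: One_nat_def)
    qed
  qed
  have "LM_sigma n rho i w
      = block_apply n (\<lambda>p q v. if p = q then s i v else 0) (block_apply n R w)"
    by (simp add: LM_sigma_def Let_def R_def)
  then have "LM_sigma n rho i w p = (if p \<in> {1..n} then s i (\<Sum>q = 1..n. R p q (w q)) else 0)"
    by (simp add: block_apply_def del: One_nat_def)
  then show ?thesis by (auto simp: R simp del: One_nat_def)
qed

lemma additive_LM_sigma:
  assumes i: "i \<in> {1..<n}" shows "additive (LM_sigma n rho i)"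
proof
  fix u w
  have "i \<in> {1..n}" "i + 1 \<in> {1..n}" using i by auto
  then show "LM_sigma n rho i (u + w) = LM_sigma n rho i u + LM_sigma n rho i w"
    using i by (auto simp: fun_eq_iff LM_sigma_apply g_simps s_simps algebra_simps
        simp del: One_nat_def)
qed

lemma LM_sigma_fscale:
  assumes i: "i \<in> {1..<n}"
  shows "LM_sigma n rho i (fscale scale c w) = fscale scale c (LM_sigma n rho i w)"
proof -
  have "i \<in> {1..n}" "i + 1 \<in> {1..n}" using i by auto
  then show ?thesis
    using i by (auto simp: fun_eq_iff LM_sigma_apply fscale_def g_simps s_simps
        scale_right_distrib scale_right_diff_distrib simp del: One_nat_def)
qed

lemma additive_fscale: "additive (fscale scale c)"
  by standard (simp add: fscale_def fun_eq_iff scale_right_distrib)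

text \<open>The blocks \<open>R\<^sub>i\<close> and \<open>R\<^sub>j\<close> occupy disjoint rows, and \<open>s\<^sub>j\<close> commutes with the entries
  of \<open>R\<^sub>i\<close> because \<open>j\<close> and \<open>j + 1\<close> both differ from \<open>i\<close> and \<open>i + 1\<close>.\<close>

lemma LM_sigma_commute:
  assumes i: "i \<in> {1..<n}" and j: "j \<in> {1..<n}" and ij: "i + 2 \<le> j"
  shows "LM_sigma n rho i (LM_sigma n rho j w) = LM_sigma n rho j (LM_sigma n rho i w)"
proof -
  have "i \<in> {1..n}" "i + 1 \<in> {1..n}" "j \<in> {1..n}" "j + 1 \<in> {1..n}" using i j by auto
  moreover have "s i (g j v) = g j (s i v)" "s i (g (j + 1) v) = g (j + 1) (s i v)"
    "g i (s j v) = s j (g i v)" "g (i + 1) (s j v) = s j (g (i + 1) v)" for v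
    using i j ij by (auto simp: s_g_other)
  ultimately show ?thesis
    using i j ij s_commute[OF i j ij]
    by (auto simp: fun_eq_iff LM_sigma_apply g_simps s_simps simp del: One_nat_def)
qed


section \<open>The subspace \<open>K + L\<close>\<close>

lemma LM_sigma_KLM_K:
  assumes i: "i \<in> {1..<n}" and w: "w \<in> KLM_K n rho"
  shows "LM_sigma n rho i w \<in> KLM_K n rho"
proof -
  have ii: "i \<in> {1..n}" "i + 1 \<in> {1..n}" using i by auto
  have fixed: "g j (w j) = w j" if "j \<in> {1..n}" for j
    using w that by (simp add: KLM_K_def del: One_nat_def)
  have "g i (s i (g i (w (i + 1)))) = s i (g i (w (i + 1)))"
    by (simp only: s_g_g[OF i, symmetric] fixed ii)
  moreover have "g (i + 1) (s i (w i)) = s i (w i)"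
    by (simp only: s_g_same[OF i, symmetric] fixed ii)
  moreover have "g j (s i (w j)) = s i (w j)" if "j \<in> {1..n}" "j \<noteq> i" "j \<noteq> i + 1" for j
    by (simp only: s_g_other[OF i that, symmetric] fixed that)
  ultimately show ?thesis
    using ii i fixed[OF ii(2)]
    by (auto simp: KLM_K_def power_space_def LM_sigma_apply simp del: One_nat_def)
qed

text \<open>With \<open>D\<^sub>q = g\<^sub>q w\<^sub>q - w\<^sub>q\<close> and \<open>C\<^sub>j = D\<^sub>1 + \<dots> + D\<^sub>j\<^sub>-\<^sub>1 + g\<^sub>j w\<^sub>j\<close>, the fixed-point equation of
  \<open>\<rho>\<^sup>L\<^sup>M(x\<^sub>j)\<close>, whose only nontrivial row is the \<open>j\<close>-th, reads
  \<open>(C\<^sub>n - w\<^sub>n) + (\<lambda> - 1) C\<^sub>j = 0\<close>. As \<open>\<lambda> \<noteq> 1\<close>, these \<open>n\<close> equations hold together iff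
  \<open>C\<^sub>j\<close> is constant in \<open>j\<close> and one of them holds. Constancy is the chain of conditions, since
  \<open>C\<^sub>j\<^sub>+\<^sub>1 - C\<^sub>j = g\<^sub>j\<^sub>+\<^sub>1 w\<^sub>j\<^sub>+\<^sub>1 - w\<^sub>j\<close>; the remaining equation is then \<open>\<lambda> C\<^sub>1 = w\<^sub>n\<close>.\<close>

lemma KLM_L_iff:
  assumes lam: "lam \<noteq> 1" and n: "n \<ge> 1"
  shows "w \<in> KLM_L scale n rho lam \<longleftrightarrow> w \<in> power_space n \<and>
    (\<forall>j\<in>{1..<n}. w j = g (j + 1) (w (j + 1))) \<and> scale lam (g 1 (w 1)) = w n"
proof -
  define D where "D q = g q (w q) - w q" for q
  define C where "C j = (\<Sum>q = 1..<j. D q) + g j (w j)" for j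
  have row: "LM_x scale n rho lam j w j - w j = C n - w n + scale (lam - 1) (C j)"
    if j: "j \<in> {1..n}" for j
  proof -
    have "LM_x scale n rho lam j w j = (\<Sum>q = 1..n. D q + (if q < j then scale (lam - 1) (D q) else 0)
        + (if q = j then scale (lam - 1) (g q (w q)) + w q else 0))"
      using j unfolding LM_x_def Let_def block_apply_def
      by (auto intro!: sum.cong simp: D_def scale_left_diff_distrib simp del: One_nat_def)
    also have "\<dots> = (\<Sum>q = 1..n. D q) + (\<Sum>q = 1..n. if q < j then scale (lam - 1) (D q) else 0)
        + (scale (lam - 1) (g j (w j)) + w j)"
      using j by (simp add: sum.distrib del: One_nat_def)
    also have "(\<Sum>q = 1..n. if q < j then scale (lam - 1) (D q) else 0)
        = (\<Sum>q = 1..<j. scale (lam - 1) (D q))"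
      using j by (intro sum.mono_neutral_cong_right) auto
    also have "(\<Sum>q = 1..n. D q) = (\<Sum>q = 1..<n. D q) + D n"
      using n by (simp add: sum.last_plus add.commute)
    finally show ?thesis
      by (simp add: C_def D_def scale_right_distrib scale_sum_right)
  qed
  have "LM_x scale n rho lam j w - w = 0 \<longleftrightarrow> LM_x scale n rho lam j w j - w j = 0"
    if w: "w \<in> power_space n" and j: "j \<in> {1..n}" for j
  proof -
    have "LM_x scale n rho lam j w p = w p" if "p \<noteq> j" for p
      using that w unfolding LM_x_def Let_def block_apply_def power_space_def
      by (auto simp del: One_nat_def)
    then have "LM_x scale n rho lam j w = w \<longleftrightarrow> LM_x scale n rho lam j w j = w j"
      by (metis ext)
    then show ?thesis by simp
  qed
  then have L: "w \<in> KLM_L scale n rho lam \<longleftrightarrow> w \<in> power_space n \<and>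
      (\<forall>j\<in>{1..n}. C n - w n + scale (lam - 1) (C j) = 0)"
    unfolding KLM_L_def using row by (auto simp del: One_nat_def)
  have C1: "C 1 = g 1 (w 1)" by (simp add: C_def)
  have step: "C (j + 1) - C j = g (j + 1) (w (j + 1)) - w j" if "j \<ge> 1" for j
    using that by (simp add: C_def D_def)
  have const: "C j = C 1" if "\<forall>j\<in>{1..<n}. w j = g (j + 1) (w (j + 1))" "j \<in> {1..n}" for j
  proof -
    have "1 \<le> j" "j \<le> n" using that(2) by auto
    then show ?thesis
    proof (induction j rule: dec_induct)
      case (step j)
      then show ?case using that(1) \<open>\<And>j. j \<ge> 1 \<Longrightarrow> C (j + 1) - C j = _ j\<close>[of j] by simp
    qed simp
  qed
  show ?thesis
  proof (intro iffI)
    assume "w \<in> KLM_L scale n rho lam"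
    then have w: "w \<in> power_space n"
      and C: "\<And>j. j \<in> {1..n} \<Longrightarrow> C n - w n + scale (lam - 1) (C j) = 0"
      using L by auto
    have eq: "C j = C 1" if "j \<in> {1..n}" for j
    proof -
      have "scale (lam - 1) (C j) = scale (lam - 1) (C 1)"
        using C[OF that] C[of 1] n by (metis add_left_imp_eq atLeastAtMost_iff le_refl)
      then show ?thesis using lam by simp
    qed
    have "w j = g (j + 1) (w (j + 1))" if "j \<in> {1..<n}" for j
      using step[of j] eq[of j] eq[of "j + 1"] that by simp
    moreover have "scale lam (g 1 (w 1)) = w n"
      using C[of 1] eq[of n] n C1 by (simp add: scale_left_diff_distrib)
    ultimately show "w \<in> power_space n \<and>
        (\<forall>j\<in>{1..<n}. w j = g (j + 1) (w (j + 1))) \<and> scale lam (g 1 (w 1)) = w n"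
      using w by blast
  next
    assume *: "w \<in> power_space n \<and>
        (\<forall>j\<in>{1..<n}. w j = g (j + 1) (w (j + 1))) \<and> scale lam (g 1 (w 1)) = w n"
    have "C n - w n + scale (lam - 1) (C j) = 0" if "j \<in> {1..n}" for j
      using * const[OF _ that] const[of n] n C1 by (simp add: scale_left_diff_distrib)
    then show "w \<in> KLM_L scale n rho lam" using L * by blast
  qed
qed

text \<open>On \<open>L\<close> the block \<open>R\<^sub>i\<close> simplifies: the relation \<open>w\<^sub>i = g\<^sub>i\<^sub>+\<^sub>1 w\<^sub>i\<^sub>+\<^sub>1\<close> collapses the entry in place
  \<open>i + 1\<close> to \<open>s\<^sub>i w\<^sub>i\<^sub>+\<^sub>1\<close>. Hence the image \<open>u\<close> has \<open>u\<^sub>p = s\<^sub>i w\<^sub>p\<close> except at \<open>p = i\<close>, and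
  \<open>g\<^sub>p u\<^sub>p = s\<^sub>i g\<^sub>p w\<^sub>p\<close> except at \<open>p = i + 1\<close>, so only the link between \<open>i\<close> and \<open>i + 1\<close> is not simply
  \<open>s\<^sub>i\<close> applied to the old one.\<close>

lemma LM_sigma_KLM_L:
  assumes lam: "lam \<noteq> 1" and i: "i \<in> {1..<n}" and w: "w \<in> KLM_L scale n rho lam"
  shows "LM_sigma n rho i w \<in> KLM_L scale n rho lam"
proof -
  have n: "n \<ge> 1" and ii: "i \<in> {1..n}" "i + 1 \<in> {1..n}" using i by auto
  define u where "u = LM_sigma n rho i w"
  have next_w: "g (j + 1) (w (j + 1)) = w j" if "j \<in> {1..<n}" for j
    using w that unfolding KLM_L_iff[OF lam n] by auto
  have cyc: "scale lam (g 1 (w 1)) = w n"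
    using w unfolding KLM_L_iff[OF lam n] by auto
  have u_i: "u i = s i (g i (w (i + 1)))"
    unfolding u_def using i ii by (simp add: LM_sigma_apply del: One_nat_def)
  have u_other: "u p = s i (w p)" if "p \<in> {1..n}" "p \<noteq> i" for p
    unfolding u_def using i ii next_w[OF i] that
    by (auto simp: LM_sigma_apply g_simps s_simps simp del: One_nat_def)
  have g_u_i: "g i (u i) = s i (g i (w i))"
    unfolding u_i by (simp only: s_g_g[OF i, symmetric] next_w[OF i])
  have g_u_other: "g p (u p) = s i (g p (w p))" if "p \<in> {1..n}" "p \<noteq> i" "p \<noteq> i + 1" for p
    by (simp only: u_other[OF that(1,2)] s_g_other[OF i that])
  have "u j = g (j + 1) (u (j + 1))" if j: "j \<in> {1..<n}" for j
  proof -
    have jj: "j \<in> {1..n}" "j + 1 \<in> {1..n}" using j by auto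
    consider "j = i" | "j + 1 = i" | "j \<noteq> i" "j + 1 \<noteq> i" by blast
    then show ?thesis
    proof cases
      case 1
      then show ?thesis using u_other[OF ii(2)] s_g_same[OF i] u_i by simp
    next
      case 2
      then show ?thesis using u_other[OF jj(1)] g_u_i next_w[OF j] by simp
    next
      case 3
      then show ?thesis using u_other[OF jj(1)] g_u_other[OF jj(2)] next_w[OF j] by simp
    qed
  qed
  moreover have "scale lam (g 1 (u 1)) = u n"
  proof -
    have "g 1 (u 1) = s i (g 1 (w 1))"
      using g_u_i g_u_other[of 1] n i by (cases "i = 1") auto
    moreover have "u n = s i (w n)" using u_other[of n] n i by auto
    ultimately show ?thesis
      using cyc s_hom[OF i, THEN module_hom.scale, of lam "g 1 (w 1)"] by simp
  qed
  moreover have "u \<in> power_space n"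
    unfolding u_def power_space_def using i by (simp add: LM_sigma_apply del: One_nat_def)
  ultimately show ?thesis unfolding u_def[symmetric] KLM_L_iff[OF lam n] by blast
qed

lemma KLM_sub_subspace:
  assumes lam: "lam \<noteq> 1" and n: "n \<ge> 1"
  shows "additive_subgroup (KLM_sub scale n rho lam)"
    and "fscale scale c ` KLM_sub scale n rho lam \<subseteq> KLM_sub scale n rho lam"
proof -
  let ?K = "KLM_K n rho" and ?L = "KLM_L scale n rho lam"
  have K: "0 \<in> ?K" "\<And>x y. x \<in> ?K \<Longrightarrow> y \<in> ?K \<Longrightarrow> x - y \<in> ?K"
    "\<And>x. x \<in> ?K \<Longrightarrow> fscale scale c x \<in> ?K"
    by (auto simp: KLM_K_def power_space_def fscale_def g_simps simp del: One_nat_def)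
  have n1: "1 \<in> {1..n}" using n by simp
  have L: "0 \<in> ?L" "\<And>x y. x \<in> ?L \<Longrightarrow> y \<in> ?L \<Longrightarrow> x - y \<in> ?L"
    "\<And>x. x \<in> ?L \<Longrightarrow> fscale scale c x \<in> ?L"
    using n1 unfolding KLM_L_iff[OF lam n]
    by (auto simp: power_space_def fscale_def g_simps scale_right_diff_distrib scale_left_commute[of lam]
        simp del: One_nat_def scale_scale)
  show "additive_subgroup (KLM_sub scale n rho lam)"
  proof
    show "0 \<in> KLM_sub scale n rho lam"
      unfolding KLM_sub_def using set_plus_intro[OF K(1) L(1)] by simp
  next
    fix x y assume "x \<in> KLM_sub scale n rho lam" "y \<in> KLM_sub scale n rho lam"
    then obtain a b c d where "x = a + b" "y = c + d" "a \<in> ?K" "b \<in> ?L" "c \<in> ?K" "d \<in> ?L"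
      unfolding KLM_sub_def by (metis set_plus_elim)
    then show "x - y \<in> KLM_sub scale n rho lam"
      unfolding KLM_sub_def using set_plus_intro[OF K(2)[of a c] L(2)[of b d]]
      by (simp add: algebra_simps)
  qed
  show "fscale scale c ` KLM_sub scale n rho lam \<subseteq> KLM_sub scale n rho lam"
    unfolding KLM_sub_def
    by (auto elim!: set_plus_elim simp: additive.add[OF additive_fscale] intro!: set_plus_intro K L)
qed

lemma LM_sigma_KLM_sub:
  assumes "lam \<noteq> 1" "i \<in> {1..<n}"
  shows "LM_sigma n rho i ` KLM_sub scale n rho lam \<subseteq> KLM_sub scale n rho lam"
  unfolding KLM_sub_def using assms
  by (auto elim!: set_plus_elim simp: additive.add[OF additive_LM_sigma] simp del: One_nat_def
      intro!: set_plus_intro LM_sigma_KLM_K LM_sigma_KLM_L)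

end


section \<open>Hecke and Temperley--Lieb relations on the quotient\<close>

theorem mainTheorem8:
  fixes scale :: "'k::field \<Rightarrow> 'v::ab_group_add \<Rightarrow> 'v"
    and Basis :: "'v set"
    and n :: nat
    and rho :: "nat word set \<times> nat word set \<Rightarrow> 'v \<Rightarrow> 'v"
    and lam a b mu :: 'k
    and W :: "(nat \<Rightarrow> 'v) set"
    and Vn :: "(nat \<Rightarrow> 'v) set"
    and Q :: "(nat \<Rightarrow> 'v) set set"
    and X oneX :: "nat \<Rightarrow> (nat \<Rightarrow> 'v) \<Rightarrow> nat \<Rightarrow> 'v"
    and T oneT :: "nat \<Rightarrow> (nat \<Rightarrow> 'v) set \<Rightarrow> (nat \<Rightarrow> 'v) set"
  assumes V: "finite_dimensional_vector_space scale Basis"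
    and n: "n \<ge> 2"
    and rho: "rho \<in> hom (free_braid n) (GL scale)"
    and lam: "lam \<noteq> 0" "lam \<noteq> 1"
    and ab: "a \<noteq> 0" "b \<noteq> 0"
    and mu: "mu = - b / a"
    and Vn: "Vn = power_space n"
    and W: "W = KLM_sub scale n rho lam"
    and Q: "Q = quot_space Vn W"
    and X: "\<And>i w. X i w = fscale scale (inverse a) (LM_sigma n rho i w)"
    and oneX: "\<And>i w. oneX i w = w - X i w"
    and T: "\<And>i A. T i A = quot_map W (fscale scale (inverse a)) (KLM_sigma scale n rho lam i A)"
    and oneT: "\<And>i A. oneT i A = quot_map2 W (-) A (T i A)"
    and Hecke_X: "\<And>i. 1 \<le> i \<Longrightarrow> i \<le> n - 1 \<Longrightarrow>
      ((\<lambda>w. X i w - w) \<circ> (\<lambda>w. X i w + fscale scale mu w)) ` Vn \<subseteq> W"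
  shows
    "(\<forall>i\<in>{1..n-1}. \<forall>A\<in>Q.
        (let B = quot_map2 W (+) (T i A) (quot_map W (fscale scale mu) A)
         in quot_map2 W (-) (T i B) B = W))
     \<and>
     ((\<forall>i\<in>{1..n-1}. \<forall>A\<in>Q.
          oneT i (oneT i A) = quot_map W (fscale scale (1 + mu)) (oneT i A)) \<and>
      (\<forall>i\<in>{1..n-1}. \<forall>j\<in>{1..n-1}. j = i + 1 \<or> i = j + 1 \<longrightarrow> (\<forall>A\<in>Q.
          oneT i (oneT j (oneT i A)) = quot_map W (fscale scale mu) (oneT i A)))
      \<longleftrightarrow>
      (\<forall>i\<in>{1..n-2}.
          (\<lambda>w. oneX i (oneX (i + 1) (oneX i w)) - fscale scale mu (oneX i w)) ` Vn \<subseteq> W) \<and>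
      (\<forall>i\<in>{1..n-2}.
          (\<lambda>w. oneX (i + 1) (oneX i (oneX (i + 1) w)) - fscale scale mu (oneX (i + 1) w)) ` Vn \<subseteq> W))
     \<and>
     (\<forall>i\<in>{1..n-1}. \<forall>j\<in>{1..n-1}. i + 2 \<le> j \<or> j + 2 \<le> i \<longrightarrow> (\<forall>A\<in>Q.
          oneT i (oneT j A) = oneT j (oneT i A)))"
  proof -
  interpret V: finite_dimensional_vector_space scale Basis by (rule V)
  interpret free_braid_rep scale n rho by unfold_locales (rule rho)
  have n1: "n \<ge> 1" using n by simp
  interpret W: additive_subgroup W
    unfolding W by (rule KLM_sub_subspace(1)[OF lam(2) n1])
  have range: "{1..n-1} = {1..<n}" using n by auto
  have scale_W: "fscale scale c ` W \<subseteq> W" for c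
    unfolding W by (rule KLM_sub_subspace(2)[OF lam(2) n1])
  have scale_coset: "quot_map W (fscale scale c) (v +o W) = fscale scale c v +o W" for c v
    by (rule W.quot_map_coset[OF additive_fscale scale_W])
  have T_coset: "T i (v +o W) = X i v +o W" if "i \<in> {1..<n}" for i v
  proof -
    have "KLM_sigma scale n rho lam i (v +o W) = LM_sigma n rho i v +o W"
      unfolding KLM_sigma_def W[symmetric]
      by (rule W.quot_map_coset[OF additive_LM_sigma[OF that]])
        (unfold W, rule LM_sigma_KLM_sub[OF lam(2) that])
    then show ?thesis by (simp add: T X scale_coset)
  qed
  have oneT_coset: "oneT i (v +o W) = oneX i v +o W" if "i \<in> {1..<n}" for i v
    using that by (simp add: oneT oneX T_coset W.quot_map2_diff_coset)
  have X_add: "X i (u + v) = X i u + X i v" and X_diff: "X i (u - v) = X i u - X i v"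
    and X_scale: "X i (fscale scale c v) = fscale scale c (X i v)"
    if "i \<in> {1..<n}" for i u v c
    using additive.add[OF additive_LM_sigma[OF that]] additive.diff[OF additive_LM_sigma[OF that]]
      additive.add[OF additive_fscale] additive.diff[OF additive_fscale]
    by (simp_all add: X LM_sigma_fscale[OF that]) (simp add: fscale_def mult.commute)
  have Hecke: "X i (X i v + fscale scale mu v) - (X i v + fscale scale mu v) \<in> W"
    if "i \<in> {1..<n}" "v \<in> Vn" for i v
    using Hecke_X[of i] that by (auto simp: image_subset_iff)
  have Q_cases: "\<exists>v\<in>Vn. A = v +o W" if "A \<in> Q" for A
    using that by (auto simp: Q quot_space_def)
  have Q_coset: "v +o W \<in> Q" if "v \<in> Vn" for v
    using that by (auto simp: Q quot_space_def)

  have TL: "(\<forall>A\<in>Q. oneT i (oneT j (oneT i A)) = quot_map W (fscale scale mu) (oneT i A))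
      \<longleftrightarrow> (\<lambda>w. oneX i (oneX j (oneX i w)) - fscale scale mu (oneX i w)) ` Vn \<subseteq> W"
    if "i \<in> {1..<n}" "j \<in> {1..<n}" for i j
  proof -
    have "oneT i (oneT j (oneT i (v +o W))) = quot_map W (fscale scale mu) (oneT i (v +o W))
        \<longleftrightarrow> oneX i (oneX j (oneX i v)) - fscale scale mu (oneX i v) \<in> W" for v
      using that by (simp add: oneT_coset scale_coset W.coset_eq_iff)
    then show ?thesis using Q_cases Q_coset unfolding image_subset_iff by metis
  qed
  have hecke_T: "\<forall>i\<in>{1..n-1}. \<forall>A\<in>Q.
        (let B = quot_map2 W (+) (T i A) (quot_map W (fscale scale mu) A)
         in quot_map2 W (-) (T i B) B = W)"
  proof (intro ballI)
    fix i A assume "i \<in> {1..n-1}" "A \<in> Q"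
    then have i: "i \<in> {1..<n}" unfolding range by simp
    obtain v where "v \<in> Vn" "A = v +o W" using Q_cases[OF \<open>A \<in> Q\<close>] by blast
    then show "let B = quot_map2 W (+) (T i A) (quot_map W (fscale scale mu) A)
         in quot_map2 W (-) (T i B) B = W"
      using Hecke[OF i, of v]
      by (simp add: Let_def T_coset[OF i] scale_coset W.quot_map2_add_coset
          W.quot_map2_diff_coset W.coset_eq_self_iff)
  qed
  have quadratic: "\<forall>i\<in>{1..n-1}. \<forall>A\<in>Q.
          oneT i (oneT i A) = quot_map W (fscale scale (1 + mu)) (oneT i A)"
  proof (intro ballI)
    fix i A assume "i \<in> {1..n-1}" "A \<in> Q"
    then have i: "i \<in> {1..<n}" unfolding range by simp
    obtain v where v: "v \<in> Vn" "A = v +o W" using Q_cases[OF \<open>A \<in> Q\<close>] by blast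
    have "oneX i (oneX i v) - fscale scale (1 + mu) (oneX i v)
        = X i (X i v + fscale scale mu v) - (X i v + fscale scale mu v)"
      unfolding oneX X_add[OF i] X_diff[OF i] X_scale[OF i]
      by (simp add: fun_eq_iff fscale_def V.scale_left_distrib V.scale_right_diff_distrib)
    then show "oneT i (oneT i A) = quot_map W (fscale scale (1 + mu)) (oneT i A)"
      using Hecke[OF i v(1)]
      by (simp add: v(2) oneT_coset[OF i] scale_coset W.coset_eq_iff)
  qed
  have temperley_lieb: "(\<forall>i\<in>{1..n-1}. \<forall>j\<in>{1..n-1}. j = i + 1 \<or> i = j + 1 \<longrightarrow> (\<forall>A\<in>Q.
          oneT i (oneT j (oneT i A)) = quot_map W (fscale scale mu) (oneT i A)))
      \<longleftrightarrow>
      (\<forall>i\<in>{1..n-2}.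
          (\<lambda>w. oneX i (oneX (i + 1) (oneX i w)) - fscale scale mu (oneX i w)) ` Vn \<subseteq> W) \<and>
      (\<forall>i\<in>{1..n-2}.
          (\<lambda>w. oneX (i + 1) (oneX i (oneX (i + 1) w)) - fscale scale mu (oneX (i + 1) w)) ` Vn \<subseteq> W)"
    (is "?L \<longleftrightarrow> ?R")
  proof -
    define P where "P i j \<longleftrightarrow>
      (\<lambda>w. oneX i (oneX j (oneX i w)) - fscale scale mu (oneX i w)) ` Vn \<subseteq> W" for i j
    have "?L \<longleftrightarrow> (\<forall>i\<in>{1..<n}. \<forall>j\<in>{1..<n}. j = i + 1 \<or> i = j + 1 \<longrightarrow> P i j)"
      unfolding range P_def using TL by (auto simp del: One_nat_def)
    also have "\<dots> \<longleftrightarrow> (\<forall>i\<in>{1..n-2}. P i (i + 1)) \<and> (\<forall>i\<in>{1..n-2}. P (i + 1) i)"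
    proof -
      have "i \<in> {1..n-2} \<longleftrightarrow> i \<in> {1..<n} \<and> i + 1 \<in> {1..<n}" for i
        using n by auto
      then show ?thesis by metis
    qed
    finally show ?thesis unfolding P_def .
  qed
  have far: "\<forall>i\<in>{1..n-1}. \<forall>j\<in>{1..n-1}. i + 2 \<le> j \<or> j + 2 \<le> i \<longrightarrow> (\<forall>A\<in>Q.
          oneT i (oneT j A) = oneT j (oneT i A))"
  proof (intro ballI impI)
    fix i j A assume ij: "i \<in> {1..n-1}" "j \<in> {1..n-1}" "i + 2 \<le> j \<or> j + 2 \<le> i" and "A \<in> Q"
    then have i: "i \<in> {1..<n}" and j: "j \<in> {1..<n}" unfolding range by simp_all
    obtain v where v: "A = v +o W" using Q_cases[OF \<open>A \<in> Q\<close>] by blast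
    have "LM_sigma n rho i (LM_sigma n rho j v) = LM_sigma n rho j (LM_sigma n rho i v)"
      using LM_sigma_commute[OF i j] LM_sigma_commute[OF j i] ij(3) by metis
    then have "X i (X j v) = X j (X i v)"
      by (simp add: X LM_sigma_fscale[OF i] LM_sigma_fscale[OF j])
    then have "oneX i (oneX j v) = oneX j (oneX i v)"
      unfolding oneX X_diff[OF i] X_diff[OF j] by simp
    then show "oneT i (oneT j A) = oneT j (oneT i A)"
      by (simp add: v oneT_coset[OF i] oneT_coset[OF j])
  qed
  have "P \<and> L \<longleftrightarrow> R" if P "L \<longleftrightarrow> R" for P L R
    using that by blast
  from this[OF quadratic temperley_lieb] show ?thesis
    by (rule conjI[OF hecke_T conjI[OF _ far]])
qed

end
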